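(* The restriction energy condition implies the embedding: for every $C>0$ there is a constant $C_1>0$ depending only on $C$ such that for every $N\ge1$ and every non-negative measure $\mu$ on $\partial T^2$ (with $T$ the dyadic tree of depth $N$) satisfying $$\mathcal E[\mu|E]\le C\,\mu(E)\qquad\text{for all }E\subset\partial T^2,$$ one has $$\sum_{\omega\in\partial T^2}|\mathbb I\varphi(\omega)|^2\,\mu(\omega)\le C_1\,\|\varphi\|^2_{\ell^2(T^2)}\qquad\text{for all }\varphi:T^2\to\mathbb R.$$
   Context: $T$ is the finite dyadic tree of depth $N$: its nodes are the dyadic subintervals of $[0,1]$ of length $2^{-k}$, $0\le k\le N$; its boundary $\partial T$ is the set of dyadic intervals of length $2^{-N}$. The bi-tree is $T^2=T\times T$; a node $\alpha\in T^2$ is identified with the dyadic rectangle $R_\alpha\subset[0,1]^2$, and $\alpha\le\beta$ means $R_\alpha\subset R_\beta$. The boundary $\partial T^2=(\partial T)^2$ consists of the dyadic squares $\omega$ of side $2^{-N}$. A measure $\mu$ on $\partial T^2$ assigns a finite mass $\mu(\omega)\ge0$ to each $\omega\in\partial T^2$. For a dyadic rectangle, $\mu(R_\alpha)=\sum_{\omega\in\partial T^2,\ \omega\le\alpha}\mu(\omega)$; for $E\subset\partial T^2$, $\mu(E)=\sum_{\omega\in E}\mu(\omega)$. The restriction $\mu|E$ is the measure with $(\mu|E)(\omega)=\mu(\omega)$ if $\omega\in E$ and $0$ otherwise. The energy of a measure $\nu$ is $\mathcal E[\nu]=\sum_{\alpha\in T^2}\nu(R_\alpha)^2$. The Hardy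 operator is $\mathbb I\varphi(\alpha)=\sum_{\beta\ge\alpha}\varphi(\beta)$, and $\|\varphi\|^2_{\ell^2(T^2)}=\sum_{\alpha\in T^2}\varphi(\alpha)^2$. *)

theory Defs
  imports Complex_Main
begin

definition dyadic_interval :: "nat \<Rightarrow> nat \<Rightarrow> real set" where
  "dyadic_interval k j = {real j / 2 ^ k .. real (j + 1) / 2 ^ k}"

definition dyadic_tree :: "nat \<Rightarrow> real set set" where
  "dyadic_tree N = {dyadic_interval k j | k j. k \<le> N \<and> j < 2 ^ k}"

definition tree_boundary :: "nat \<Rightarrow> real set set" where
  "tree_boundary N = {dyadic_interval N j | j. j < 2 ^ N}"

type_synonym node = "real set \<times> real set"

definition bitree :: "nat \<Rightarrow> node set" where
  "bitree N = dyadic_tree N \<times> dyadic_tree N"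

definition bitree_boundary :: "nat \<Rightarrow> node set" where
  "bitree_boundary N = tree_boundary N \<times> tree_boundary N"

definition rect :: "node \<Rightarrow> (real \<times> real) set" where
  "rect \<alpha> = fst \<alpha> \<times> snd \<alpha>"

definition node_le :: "node \<Rightarrow> node \<Rightarrow> bool"  (infix "\<preceq>" 50) where
  "\<alpha> \<preceq> \<beta> \<longleftrightarrow> rect \<alpha> \<subseteq> rect \<beta>"

(* A measure on the boundary of the bi-tree of depth N is a function node => real that is
   nonnegative on bitree_boundary N; its values elsewhere are never used. *)

definition measure_on_boundary :: "nat \<Rightarrow> (node \<Rightarrow> real) \<Rightarrow> bool" where
  "measure_on_boundary N \<mu> \<longleftrightarrow> (\<forall>\<omega>\<in>bitree_boundary N. 0 \<le> \<mu> \<omega>)"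

definition set_mass :: "(node \<Rightarrow> real) \<Rightarrow> node set \<Rightarrow> real" where
  "set_mass \<mu> E = (\<Sum>\<omega>\<in>E. \<mu> \<omega>)"

definition rect_mass :: "nat \<Rightarrow> (node \<Rightarrow> real) \<Rightarrow> node \<Rightarrow> real" where
  "rect_mass N \<mu> \<alpha> = (\<Sum>\<omega> | \<omega> \<in> bitree_boundary N \<and> \<omega> \<preceq> \<alpha>. \<mu> \<omega>)"

definition restrict_measure :: "(node \<Rightarrow> real) \<Rightarrow> node set \<Rightarrow> node \<Rightarrow> real" where
  "restrict_measure \<mu> E = (\<lambda>\<omega>. if \<omega> \<in> E then \<mu> \<omega> else 0)"

definition energy :: "nat \<Rightarrow> (node \<Rightarrow> real) \<Rightarrow> real" where
  "energy N \<nu> = (\<Sum>\<alpha>\<in>bitree N. (rect_mass N \<nu> \<alpha>)\<^sup>2)"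

definition hardy :: "nat \<Rightarrow> (node \<Rightarrow> real) \<Rightarrow> node \<Rightarrow> real" where
  "hardy N \<phi> \<alpha> = (\<Sum>\<beta> | \<beta> \<in> bitree N \<and> \<alpha> \<preceq> \<beta>. \<phi> \<beta>)"

definition l2_norm_sq :: "nat \<Rightarrow> (node \<Rightarrow> real) \<Rightarrow> real" where
  "l2_norm_sq N \<phi> = (\<Sum>\<alpha>\<in>bitree N. (\<phi> \<alpha>)\<^sup>2)"

lemma finite_dyadic_tree: "finite (dyadic_tree N)"
proof -
  have "dyadic_tree N = (\<lambda>(k, j). dyadic_interval k j) ` (SIGMA k:{..N}. {..<2 ^ k})"
    unfolding dyadic_tree_def by auto
  then show ?thesis by simp
qed

lemma finite_bitree: "finite (bitree N)"
  unfolding bitree_def by (simp add: finite_dyadic_tree)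

lemma bitree_boundary_subset: "bitree_boundary N \<subseteq> bitree N"
  unfolding bitree_boundary_def bitree_def tree_boundary_def dyadic_tree_def by blast

lemma finite_bitree_boundary: "finite (bitree_boundary N)"
  using bitree_boundary_subset finite_bitree by (rule finite_subset)

end

theory Submission
  imports Defs "HOL-Analysis.Convex"
begin

text \<open>
  Write \<open>f\<close> for the function \<open>\<alpha> \<mapsto> \<mu>(E \<inter> R\<^sub>\<alpha>)\<close>, so that the energy of \<open>\<mu>|E\<close> is the square of the
  \<open>\<ell>\<^sup>2\<close>-norm of \<open>f\<close> and the Hardy sum \<open>V\<close> of \<open>f\<close> is the potential of \<open>\<mu>|E\<close>.  Testing
  the embedding against restrictions of \<open>\<mu>\<close> gives only a weak-type bound.  On a single tree it
  is upgraded to the strong one by Hansson's duality argument, which rests on the maximum principle: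
  a potential bounded by \<open>d\<close> on the support of its measure is bounded by \<open>d\<close> everywhere.  This fails
  on a bi-tree, because along the ancestors of a point \<open>f\<close> may be spread over many rectangles
  none of which contains another.  It has a substitute: a potential can exceed \<open>d\<close>, but only
  on a set of small capacity.

  Let \<open>V \<le> d\<close> on \<open>E\<close>, and let \<open>I1 f\<close> and \<open>I2 f\<close> be the Hardy sums of \<open>f\<close> in one variable.
  Expand \<open>V\<^sup>2\<close> at a point as a double sum over pairs of ancestor rectangles.  Nested pairs
  contribute at most \<open>2 d V\<close>, since \<open>f\<close> lives where \<open>V \<le> d\<close>.  A pair of crossing rectangles
  is charged to its intersection, which again contains the point, and the crossing
  pairs are collected by twice the Hardy sum of \<open>\<phi> = I1 f \<cdot> I2 f\<close> (\<open>II_square_le\<close>).  The gain is that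
  \<open>\<phi>\<close> has norm at most \<open>2 d\<close> times that of \<open>f\<close> (\<open>norm_majorant_le\<close>), although \<open>\<phi>\<close>
  is quadratic in \<open>f\<close>; this comes from summing over descendants instead of ancestors
  (\<open>sum_descendants_mass_le\<close>).  Hence, where \<open>V\<close> is large compared with \<open>d\<close>, its square
  is dominated by the Hardy sum of \<open>\<phi>\<close>, and the
  restriction energy condition bounds the mutual energy of \<open>\<mu>|E\<close> and \<open>\<mu>|G\<close> by a multiple of
  \<open>s \<mu>(G) + \<mu>(E) / s\<^sup>3\<close> for every \<open>s \<ge> 1\<close> and every \<open>G\<close> (\<open>cross_energy_le\<close>).

  The power of \<open>s\<close> is what Hansson's argument needs.  Cut the points into the level
  sets \<open>E\<^sub>k\<close> on which the Hardy sum of a given function is about \<open>4\<^sup>k\<close>, and replace each by a subset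
  \<open>G\<^sub>k\<close> of at least half its mass on which its own potential is bounded (\<open>good_half\<close>).  With
  \<open>s = 2\<close> to the power \<open>k - j\<close>, the weighted masses of \<open>G\<^sub>j\<close> and \<open>G\<^sub>k\<close> are almost orthogonal, with
  geometric decay in \<open>\<bar>k - j\<bar>\<close> (\<open>weighted_masses_almost_orthogonal\<close>).  Duality and the
  Cauchy-Schwarz inequality conclude (\<open>Hardy_embedding_nonneg\<close>).  The property
  of dyadic intervals behind all of this is that the ancestors of a node form a chain.
\<close>

section \<open>Finite trees and Hardy sums along ancestors\<close>

definition anc :: "'a set set \<Rightarrow> 'a set \<Rightarrow> 'a set set" where
  "anc T x = {a. a \<in> T \<and> x \<subseteq> a}"

locale finite_tree =
  fixes T :: "'a set set"
  assumes finite_nodes: "finite T"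
    and ancestors_chain:
      "\<lbrakk>x \<in> T; a \<in> T; a' \<in> T; x \<subseteq> a; x \<subseteq> a'\<rbrakk> \<Longrightarrow> a \<subseteq> a' \<or> a' \<subseteq> a"
begin

lemma finite_anc [simp]: "finite (anc T x)"
  using finite_nodes by (simp add: anc_def)

lemma anc_filter: "a \<in> anc T x \<Longrightarrow> {a' \<in> anc T x. a \<subseteq> a'} = anc T a"
  by (auto simp: anc_def)

lemma anc_mono: "x \<subseteq> x' \<Longrightarrow> anc T x' \<subseteq> anc T x"
  by (auto simp: anc_def)

lemma swap_anc: "(\<Sum>x\<in>T. \<Sum>a\<in>anc T x. g x a) = (\<Sum>a\<in>T. \<Sum>x | x \<in> T \<and> x \<subseteq> a. g x a)"
  unfolding anc_def by (rule sum.swap_restrict) (simp_all add: finite_nodes)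

text \<open>
  The chain condition enters here only: two ancestors \<open>a\<close>, \<open>a'\<close> of \<open>x\<close> are nested, and each
  inner sum collects the pairs in which its index is the larger of the two.
\<close>

lemma prod_sum_anc_le:
  fixes g h :: "'a set \<Rightarrow> real"
  assumes x: "x \<in> T" and g: "\<And>a. 0 \<le> g a" and h: "\<And>a. 0 \<le> h a"
  shows "(\<Sum>a\<in>anc T x. g a) * (\<Sum>a\<in>anc T x. h a)
    \<le> (\<Sum>a\<in>anc T x. g a * (\<Sum>a'\<in>anc T a. h a')) + (\<Sum>a\<in>anc T x. h a * (\<Sum>a'\<in>anc T a. g a'))"
proof -
  let ?A = "anc T x"
  have up: "(\<Sum>a\<in>?A. p a * (\<Sum>a'\<in>anc T a. q a'))
      = (\<Sum>a\<in>?A. \<Sum>a'\<in>?A. if a \<subseteq> a' then p a * q a' else 0)" for p q :: "'a set \<Rightarrow> real"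
    by (rule sum.cong)
      (simp_all add: sum_distrib_left anc_filter [symmetric] sum.inter_filter if_distrib
        cong: if_cong)
  have "(\<Sum>a\<in>?A. g a) * (\<Sum>a\<in>?A. h a) = (\<Sum>a\<in>?A. \<Sum>a'\<in>?A. g a * h a')"
    by (simp add: sum_product)
  also have "\<dots> \<le> (\<Sum>a\<in>?A. \<Sum>a'\<in>?A. (if a \<subseteq> a' then g a * h a' else 0)
      + (if a' \<subseteq> a then h a' * g a else 0))"
  proof (intro sum_mono)
    fix a a' assume "a \<in> ?A" "a' \<in> ?A"
    then have "a \<subseteq> a' \<or> a' \<subseteq> a" using ancestors_chain [OF x] by (auto simp: anc_def)
    then show "g a * h a' \<le> (if a \<subseteq> a' then g a * h a' else 0) + (if a' \<subseteq> a then h a' * g a else 0)"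
      using g h by (auto simp: mult.commute)
  qed
  also have "\<dots> = (\<Sum>a\<in>?A. \<Sum>a'\<in>?A. if a \<subseteq> a' then g a * h a' else 0)
      + (\<Sum>a\<in>?A. \<Sum>a'\<in>?A. if a' \<subseteq> a then h a' * g a else 0)"
    by (simp add: sum.distrib)
  also have "(\<Sum>a\<in>?A. \<Sum>a'\<in>?A. if a' \<subseteq> a then h a' * g a else 0)
      = (\<Sum>a'\<in>?A. \<Sum>a\<in>?A. if a' \<subseteq> a then h a' * g a else 0)"
    by (rule sum.swap)
  finally show ?thesis by (simp add: up)
qed

end

section \<open>Two parameters\<close>

locale bi_tree = X: finite_tree T + Y: finite_tree S
  for T :: "'a set set" and S :: "'b set set"
begin

definition I1 :: "('a set \<Rightarrow> 'b set \<Rightarrow> real) \<Rightarrow> 'a set \<Rightarrow> 'b set \<Rightarrow> real" where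
  "I1 f a b = (\<Sum>a'\<in>anc T a. f a' b)"

definition I2 :: "('a set \<Rightarrow> 'b set \<Rightarrow> real) \<Rightarrow> 'a set \<Rightarrow> 'b set \<Rightarrow> real" where
  "I2 f a b = (\<Sum>b'\<in>anc S b. f a b')"

definition II :: "('a set \<Rightarrow> 'b set \<Rightarrow> real) \<Rightarrow> 'a set \<Rightarrow> 'b set \<Rightarrow> real" where
  "II f a b = (\<Sum>a'\<in>anc T a. \<Sum>b'\<in>anc S b. f a' b')"

definition pairing :: "('a set \<Rightarrow> 'b set \<Rightarrow> real) \<Rightarrow> ('a set \<Rightarrow> 'b set \<Rightarrow> real) \<Rightarrow> real" where
  "pairing f g = (\<Sum>a\<in>T. \<Sum>b\<in>S. f a b * g a b)"

lemma II_I2: "II f a b = (\<Sum>a'\<in>anc T a. I2 f a' b)"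
  by (simp add: II_def I2_def)

lemma pairing_cartesian: "pairing f g = (\<Sum>(a, b)\<in>T \<times> S. f a b * g a b)"
  by (simp add: pairing_def sum.cartesian_product)

lemma pairing_commute: "pairing f g = pairing g f"
  by (simp add: pairing_def mult.commute)

lemma pairing_sum_right: "pairing f (\<lambda>a b. \<Sum>k\<in>K. u k * g k a b) = (\<Sum>k\<in>K. u k * pairing f (g k))"
proof -
  have "pairing f (\<lambda>a b. \<Sum>k\<in>K. u k * g k a b) = (\<Sum>a\<in>T. \<Sum>b\<in>S. \<Sum>k\<in>K. u k * (f a b * g k a b))"
    by (simp add: pairing_def sum_distrib_left ac_simps)
  also have "\<dots> = (\<Sum>a\<in>T. \<Sum>k\<in>K. \<Sum>b\<in>S. u k * (f a b * g k a b))"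
    by (intro sum.cong sum.swap refl)
  also have "\<dots> = (\<Sum>k\<in>K. \<Sum>a\<in>T. \<Sum>b\<in>S. u k * (f a b * g k a b))"
    by (rule sum.swap)
  finally show ?thesis by (simp add: pairing_def sum_distrib_left)
qed

lemma pairing_self_nonneg: "0 \<le> pairing f f"
  by (simp add: pairing_def sum_nonneg)

lemma pairing_Cauchy_Schwarz: "(pairing f g)\<^sup>2 \<le> pairing f f * pairing g g"
  using Cauchy_Schwarz_ineq_sum [of "\<lambda>z. f (fst z) (snd z)" "\<lambda>z. g (fst z) (snd z)" "T \<times> S"]
  by (simp add: pairing_cartesian case_prod_beta power2_eq_square)

lemma II_nonneg: "(\<And>a b. 0 \<le> f a b) \<Longrightarrow> 0 \<le> II f x y"
  by (simp add: II_def sum_nonneg)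

lemma II_antimono:
  assumes "\<And>a b. 0 \<le> f a b" "x \<subseteq> x'" "y \<subseteq> y'"
  shows "II f x' y' \<le> II f x y"
proof -
  have "II f x' y' \<le> (\<Sum>a\<in>anc T x'. \<Sum>b\<in>anc S y. f a b)"
    unfolding II_def using assms by (intro sum_mono sum_mono2 Y.anc_mono) auto
  also have "\<dots> \<le> II f x y"
    unfolding II_def using assms by (intro sum_mono2 X.anc_mono sum_nonneg) auto
  finally show ?thesis .
qed

text \<open>
  After the first variable has been ordered by \<open>a \<subseteq> a'\<close>, the second is ordered too.  If
  also \<open>b \<subseteq> b'\<close>, the rectangles are nested, and \<open>small\<close> absorbs one factor.  If \<open>b' \<subseteq> b\<close>, they
  cross, and the product is charged to their intersection \<open>a \<times> b'\<close>: there \<open>f a b\<close> is a term of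
  \<open>I2 f\<close> and \<open>f a' b'\<close> a term of \<open>I1 f\<close>.
\<close>

lemma II_square_le:
  assumes x: "x \<in> T" and y: "y \<in> S" and f: "\<And>a b. 0 \<le> f a b"
    and small: "\<And>a b. f a b * II f a b \<le> d * f a b"
  shows "(II f x y)\<^sup>2 \<le> 2 * d * II f x y + 2 * II (\<lambda>a b. I1 f a b * I2 f a b) x y"
proof -
  have I2n: "0 \<le> I2 f a b" for a b by (simp add: I2_def sum_nonneg f)
  have "(II f x y)\<^sup>2 \<le> 2 * (\<Sum>a\<in>anc T x. I2 f a y * (\<Sum>a'\<in>anc T a. I2 f a' y))"
    using X.prod_sum_anc_le [OF x, of "\<lambda>a. I2 f a y" "\<lambda>a. I2 f a y"]
    by (simp add: II_I2 power2_eq_square I2n)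
  also have "(\<Sum>a\<in>anc T x. I2 f a y * (\<Sum>a'\<in>anc T a. I2 f a' y))
      = (\<Sum>a\<in>anc T x. \<Sum>a'\<in>anc T a. I2 f a y * I2 f a' y)"
    by (simp add: sum_distrib_left)
  also have "\<dots> \<le> (\<Sum>a\<in>anc T x. \<Sum>a'\<in>anc T a.
      (\<Sum>b\<in>anc S y. f a b * I2 f a' b) + (\<Sum>b\<in>anc S y. f a' b * I2 f a b))"
    unfolding I2_def by (intro sum_mono Y.prod_sum_anc_le y f)
  also have "\<dots> = (\<Sum>a\<in>anc T x. \<Sum>b\<in>anc S y. f a b * II f a b)
      + (\<Sum>a\<in>anc T x. \<Sum>b\<in>anc S y. I1 f a b * I2 f a b)"
  proof -
    have "(\<Sum>a'\<in>anc T a. (\<Sum>b\<in>anc S y. f a b * I2 f a' b) + (\<Sum>b\<in>anc S y. f a' b * I2 f a b))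
      = (\<Sum>b\<in>anc S y. f a b * II f a b) + (\<Sum>b\<in>anc S y. I1 f a b * I2 f a b)" for a
      unfolding sum.distrib II_I2 I1_def sum_distrib_left sum_distrib_right
      by (intro arg_cong2 [where f = "(+)"] sum.swap)
    then show ?thesis by (simp add: sum.distrib)
  qed
  also have "(\<Sum>a\<in>anc T x. \<Sum>b\<in>anc S y. f a b * II f a b) \<le> (\<Sum>a\<in>anc T x. \<Sum>b\<in>anc S y. d * f a b)"
    by (intro sum_mono small)
  also have "\<dots> = d * II f x y"
    by (simp add: II_def sum_distrib_left)
  finally show ?thesis by (simp add: II_def)
qed

text \<open>
  Each factor \<open>(I1 f)\<^sup>2\<close> and \<open>(I2 f)\<^sup>2\<close> is linearised along its chain of ancestors.  After the order of
  summation is exchanged, a sum over all descendants in the first variable stands innermost, and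
  \<open>desc\<close> trades it for \<open>d\<close> times the value of \<open>f\<close> at the top.  This step is applied twice, which accounts
  for \<open>d\<^sup>2\<close>.
\<close>

lemma norm_majorant_le:
  assumes f: "\<And>a b. 0 \<le> f a b" and d: "0 \<le> d"
    and desc: "\<And>a' b. (\<Sum>a | a \<in> T \<and> a \<subseteq> a'. f a b * I2 f a b) \<le> d * f a' b"
  shows "pairing (\<lambda>a b. I1 f a b * I2 f a b) (\<lambda>a b. I1 f a b * I2 f a b) \<le> 4 * d\<^sup>2 * pairing f f"
proof -
  have I1n: "0 \<le> I1 f a b" and I2n: "0 \<le> I2 f a b" for a b
    by (simp_all add: I1_def I2_def sum_nonneg f)
  have sq1: "(I1 f a b)\<^sup>2 \<le> 2 * (\<Sum>a'\<in>anc T a. f a' b * I1 f a' b)" if "a \<in> T" for a b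
    using X.prod_sum_anc_le [OF that, of "\<lambda>a. f a b" "\<lambda>a. f a b"]
    by (simp add: I1_def power2_eq_square f)
  have sq2: "(I2 f a b)\<^sup>2 \<le> 2 * (\<Sum>b'\<in>anc S b. f a b' * I2 f a b')" if "b \<in> S" for a b
    using Y.prod_sum_anc_le [OF that, of "f a" "f a"]
    by (simp add: I2_def power2_eq_square f)
  have "pairing (\<lambda>a b. I1 f a b * I2 f a b) (\<lambda>a b. I1 f a b * I2 f a b)
      = (\<Sum>b\<in>S. \<Sum>a\<in>T. (I1 f a b)\<^sup>2 * (I2 f a b)\<^sup>2)"
    unfolding pairing_def by (subst sum.swap) (simp add: power2_eq_square ac_simps)
  also have "\<dots> \<le> (\<Sum>b\<in>S. \<Sum>a\<in>T. (2 * (\<Sum>a'\<in>anc T a. f a' b * I1 f a' b))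
      * (2 * (\<Sum>b'\<in>anc S b. f a b' * I2 f a b')))"
    by (intro sum_mono mult_mono sq1 sq2 mult_nonneg_nonneg sum_nonneg f I1n) auto
  also have "\<dots> = 4 * (\<Sum>b\<in>S. \<Sum>a\<in>T. \<Sum>a'\<in>anc T a. f a' b * I1 f a' b
      * (\<Sum>b'\<in>anc S b. f a b' * I2 f a b'))"
  proof -
    have "(2 * (\<Sum>a'\<in>A. u a')) * (2 * z) = 4 * (\<Sum>a'\<in>A. u a' * z)" for A :: "'a set set" and u and z :: real
      by (simp add: sum_distrib_right)
    then show ?thesis by (simp only: sum_distrib_left [symmetric])
  qed
  also have "\<dots> = 4 * (\<Sum>b\<in>S. \<Sum>a'\<in>T. f a' b * I1 f a' b
      * (\<Sum>b'\<in>anc S b. \<Sum>a | a \<in> T \<and> a \<subseteq> a'. f a b' * I2 f a b'))"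
    unfolding X.swap_anc
    by (subst (2) sum.swap) (simp add: sum_distrib_left)
  also have "\<dots> \<le> 4 * (\<Sum>b\<in>S. \<Sum>a'\<in>T. f a' b * I1 f a' b * (\<Sum>b'\<in>anc S b. d * f a' b'))"
    by (intro mult_left_mono sum_mono desc mult_nonneg_nonneg f I1n) auto
  also have "\<dots> = 4 * d * (\<Sum>b\<in>S. \<Sum>a\<in>T. \<Sum>a'\<in>anc T a. f a' b * (f a b * I2 f a b))"
    by (simp add: sum_distrib_left sum_distrib_right I1_def I2_def ac_simps)
  also have "\<dots> = 4 * d * (\<Sum>b\<in>S. \<Sum>a'\<in>T. f a' b * (\<Sum>a | a \<in> T \<and> a \<subseteq> a'. f a b * I2 f a b))"
    unfolding X.swap_anc by (simp add: sum_distrib_left)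
  also have "\<dots> \<le> 4 * d * (\<Sum>b\<in>S. \<Sum>a'\<in>T. f a' b * (d * f a' b))"
    using d by (intro mult_left_mono sum_mono desc f) auto
  also have "\<dots> = 4 * d\<^sup>2 * pairing f f"
    unfolding pairing_def
    by (subst sum.swap) (simp add: sum_distrib_left power2_eq_square ac_simps)
  finally show ?thesis .
qed

end

section \<open>Measures\<close>

locale bi_tree_measure = bi_tree T S
  for T :: "'a set set" and S :: "'b set set" +
  fixes \<Omega> :: "('a set \<times> 'b set) set" and \<mu> :: "'a set \<times> 'b set \<Rightarrow> real"
  assumes points: "\<Omega> \<subseteq> T \<times> S" and \<mu>_nonneg: "\<And>\<omega>. \<omega> \<in> \<Omega> \<Longrightarrow> 0 \<le> \<mu> \<omega>"
begin

definition mass :: "('a set \<times> 'b set) set \<Rightarrow> 'a set \<Rightarrow> 'b set \<Rightarrow> real" where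
  "mass E a b = (\<Sum>\<omega> | \<omega> \<in> E \<and> fst \<omega> \<subseteq> a \<and> snd \<omega> \<subseteq> b. \<mu> \<omega>)"

abbreviation val :: "('a set \<Rightarrow> 'b set \<Rightarrow> real) \<Rightarrow> 'a set \<times> 'b set \<Rightarrow> real" where
  "val F \<omega> \<equiv> F (fst \<omega>) (snd \<omega>)"

lemma finite_points: "finite \<Omega>"
  using points by (rule finite_subset) (simp add: X.finite_nodes Y.finite_nodes)

lemma finite_sub: "E \<subseteq> \<Omega> \<Longrightarrow> finite E"
  using finite_points finite_subset by blast

lemma mass_nonneg: "E \<subseteq> \<Omega> \<Longrightarrow> 0 \<le> mass E a b"
  unfolding mass_def by (rule sum_nonneg) (use \<mu>_nonneg in auto)

lemma mass_mono: "E \<subseteq> F \<Longrightarrow> F \<subseteq> \<Omega> \<Longrightarrow> mass E a b \<le> mass F a b"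
  unfolding mass_def by (rule sum_mono2) (use \<mu>_nonneg finite_sub in auto)

lemma sum_\<mu>_nonneg: "E \<subseteq> \<Omega> \<Longrightarrow> 0 \<le> sum \<mu> E"
  by (rule sum_nonneg) (use \<mu>_nonneg in auto)

text \<open>
  The duality between the Hardy operator and \<open>\<phi> \<mapsto> mass\<close>.  Applied to \<open>\<phi> = mass E\<close> it says that
  energies are integrals of potentials.
\<close>

lemma pairing_mass:
  assumes E: "E \<subseteq> \<Omega>"
  shows "pairing \<phi> (mass E) = (\<Sum>\<omega>\<in>E. val (II \<phi>) \<omega> * \<mu> \<omega>)"
proof -
  have "pairing \<phi> (mass E) = (\<Sum>\<alpha>\<in>T \<times> S. \<Sum>\<omega> | \<omega> \<in> E \<and> fst \<omega> \<subseteq> fst \<alpha> \<and> snd \<omega> \<subseteq> snd \<alpha>. val \<phi> \<alpha> * \<mu> \<omega>)"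
    by (simp add: pairing_cartesian case_prod_beta mass_def sum_distrib_left)
  also have "\<dots> = (\<Sum>\<omega>\<in>E. \<Sum>\<alpha> | \<alpha> \<in> T \<times> S \<and> fst \<omega> \<subseteq> fst \<alpha> \<and> snd \<omega> \<subseteq> snd \<alpha>. val \<phi> \<alpha> * \<mu> \<omega>)"
    by (rule sum.swap_restrict) (use X.finite_nodes Y.finite_nodes finite_sub [OF E] in auto)
  also have "\<dots> = (\<Sum>\<omega>\<in>E. val (II \<phi>) \<omega> * \<mu> \<omega>)"
  proof (rule sum.cong [OF refl])
    fix \<omega>
    have "{\<alpha>. \<alpha> \<in> T \<times> S \<and> fst \<omega> \<subseteq> fst \<alpha> \<and> snd \<omega> \<subseteq> snd \<alpha>} = anc T (fst \<omega>) \<times> anc S (snd \<omega>)"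
      by (auto simp: anc_def)
    then show "(\<Sum>\<alpha> | \<alpha> \<in> T \<times> S \<and> fst \<omega> \<subseteq> fst \<alpha> \<and> snd \<omega> \<subseteq> snd \<alpha>. val \<phi> \<alpha> * \<mu> \<omega>) = val (II \<phi>) \<omega> * \<mu> \<omega>"
      by (simp add: II_def sum.cartesian_product sum_distrib_right case_prod_beta)
  qed
  finally show ?thesis .
qed

text \<open>
  A rectangle charged by \<open>E\<close> contains a point of \<open>E\<close>, and Hardy sums increase towards smaller rectangles.
\<close>

lemma mass_mult_potential_le:
  assumes E: "E \<subseteq> \<Omega>" and good: "\<And>\<omega>. \<omega> \<in> E \<Longrightarrow> val (II (mass E)) \<omega> \<le> d"
  shows "mass E a b * II (mass E) a b \<le> d * mass E a b"
proof -
  have "mass E a b * II (mass E) a b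
      = (\<Sum>\<omega> | \<omega> \<in> E \<and> fst \<omega> \<subseteq> a \<and> snd \<omega> \<subseteq> b. \<mu> \<omega> * II (mass E) a b)"
    by (simp add: mass_def sum_distrib_right)
  also have "\<dots> \<le> (\<Sum>\<omega> | \<omega> \<in> E \<and> fst \<omega> \<subseteq> a \<and> snd \<omega> \<subseteq> b. \<mu> \<omega> * d)"
  proof (intro sum_mono mult_left_mono)
    fix \<omega> assume w: "\<omega> \<in> {\<omega>. \<omega> \<in> E \<and> fst \<omega> \<subseteq> a \<and> snd \<omega> \<subseteq> b}"
    then have "II (mass E) a b \<le> val (II (mass E)) \<omega>"
      by (intro II_antimono mass_nonneg E) auto
    then show "II (mass E) a b \<le> d" using good [of \<omega>] w by simp
    show "0 \<le> \<mu> \<omega>" using w E by (auto intro: \<mu>_nonneg)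
  qed
  also have "\<dots> = d * mass E a b"
    by (simp add: mass_def sum_distrib_left mult.commute)
  finally show ?thesis .
qed

text \<open>
  Spread each mass into its points and sum first over the rectangles that lie between a
  point \<open>\<omega>\<close> and \<open>a' \<times> b\<close>: the values of \<open>I2\<close> along that chain add up to at most the potential at \<open>\<omega>\<close>,
  which is at most \<open>d\<close>.
\<close>

lemma sum_descendants_mass_le:
  assumes E: "E \<subseteq> \<Omega>" and good: "\<And>\<omega>. \<omega> \<in> E \<Longrightarrow> val (II (mass E)) \<omega> \<le> d"
  shows "(\<Sum>a | a \<in> T \<and> a \<subseteq> a'. mass E a b * I2 (mass E) a b) \<le> d * mass E a' b"
proof -
  let ?D = "{a. a \<in> T \<and> a \<subseteq> a'}" and ?E = "{\<omega>. \<omega> \<in> E \<and> fst \<omega> \<subseteq> a' \<and> snd \<omega> \<subseteq> b}"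
  have fin: "finite ?D" "finite ?E" using X.finite_nodes finite_sub [OF E] by auto
  have I2n: "0 \<le> I2 (mass E) a b" for a by (simp add: I2_def sum_nonneg mass_nonneg E)
  have set_eq: "{\<omega>. \<omega> \<in> E \<and> fst \<omega> \<subseteq> a \<and> snd \<omega> \<subseteq> b} = {\<omega>. \<omega> \<in> ?E \<and> fst \<omega> \<subseteq> a}" if "a \<in> ?D" for a
    using that by auto
  have "(\<Sum>a\<in>?D. mass E a b * I2 (mass E) a b)
      = (\<Sum>a\<in>?D. \<Sum>\<omega> | \<omega> \<in> ?E \<and> fst \<omega> \<subseteq> a. \<mu> \<omega> * I2 (mass E) a b)"
  proof (rule sum.cong [OF refl])
    fix a assume "a \<in> ?D"
    show "mass E a b * I2 (mass E) a b = (\<Sum>\<omega> | \<omega> \<in> ?E \<and> fst \<omega> \<subseteq> a. \<mu> \<omega> * I2 (mass E) a b)"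
      unfolding sum_distrib_right [symmetric] mass_def [of E a b] set_eq [OF \<open>a \<in> ?D\<close>] ..
  qed
  also have "\<dots> = (\<Sum>\<omega>\<in>?E. \<Sum>a | a \<in> ?D \<and> fst \<omega> \<subseteq> a. \<mu> \<omega> * I2 (mass E) a b)"
    by (rule sum.swap_restrict [OF fin])
  also have "\<dots> = (\<Sum>\<omega>\<in>?E. \<mu> \<omega> * (\<Sum>a | a \<in> ?D \<and> fst \<omega> \<subseteq> a. I2 (mass E) a b))"
    by (simp add: sum_distrib_left)
  also have "\<dots> \<le> (\<Sum>\<omega>\<in>?E. \<mu> \<omega> * d)"
  proof (intro sum_mono mult_left_mono)
    fix \<omega> assume w: "\<omega> \<in> ?E"
    have "(\<Sum>a | a \<in> ?D \<and> fst \<omega> \<subseteq> a. I2 (mass E) a b) \<le> II (mass E) (fst \<omega>) b"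
      unfolding II_I2 by (rule sum_mono2) (auto simp: I2n anc_def X.finite_nodes)
    also have "\<dots> \<le> val (II (mass E)) \<omega>"
      using w by (intro II_antimono mass_nonneg E) auto
    finally show "(\<Sum>a | a \<in> ?D \<and> fst \<omega> \<subseteq> a. I2 (mass E) a b) \<le> d" using good [of \<omega>] w by simp
    show "0 \<le> \<mu> \<omega>" using w E by (auto intro: \<mu>_nonneg)
  qed
  also have "\<dots> = d * mass E a' b"
    by (simp add: mass_def sum_distrib_left mult.commute)
  finally show ?thesis .
qed

text \<open>
  This replaces the maximum principle, which would give \<open>d \<cdot> \<mu>(G)\<close>.  Put \<open>X\<close> for the mutual energy,
  the integral of the potential of \<open>E\<close> over \<open>G\<close>.  The Cauchy-Schwarz inequality in \<open>L\<^sup>2(\<mu>|G)\<close> and \<open>II_square_le\<close> give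
  \<open>X\<^sup>2 \<le> 2 d M X + 2 M Z\<close>, where \<open>M = \<mu>(G)\<close> and \<open>Z\<close> is the integral over \<open>G\<close> of the Hardy sum of
  the majorant \<open>\<phi>\<close>.  By duality and the energy condition, \<open>Z\<close> is at most a multiple
  of \<open>sqrt (\<mu>(E) \<mu>(G))\<close>, so \<open>M Z\<close> is controlled by \<open>sqrt (\<mu>(E) M\<^sup>3)\<close>, a quantity unchanged when
  \<open>M\<close> is scaled by \<open>s\<close> and \<open>\<mu>(E)\<close> by \<open>1 / s\<^sup>3\<close>.
\<close>

lemma cross_energy_le:
  assumes E: "E \<subseteq> \<Omega>" and good: "\<And>\<omega>. \<omega> \<in> E \<Longrightarrow> val (II (mass E)) \<omega> \<le> d"
    and G: "G \<subseteq> \<Omega>" and C: "0 \<le> C" "C \<le> d" and s: "1 \<le> s"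
    and energy_E: "pairing (mass E) (mass E) \<le> C * sum \<mu> E"
    and energy_G: "pairing (mass G) (mass G) \<le> C * sum \<mu> G"
  shows "pairing (mass E) (mass G) \<le> 4 * d * (s * sum \<mu> G + sum \<mu> E / s ^ 3)"
proof -
  define V where "V = II (mass E)"
  define \<phi> where "\<phi> a b = I1 (mass E) a b * I2 (mass E) a b" for a b
  define X where "X = pairing (mass E) (mass G)"
  define Z where "Z = pairing \<phi> (mass G)"
  define m M where "m = sum \<mu> E" and "M = sum \<mu> G"
  define Y where "Y = s * M + m / s ^ 3"
  have m: "0 \<le> m" and M: "0 \<le> M" using sum_\<mu>_nonneg E G by (auto simp: m_def M_def)
  have d: "0 \<le> d" using C by simp
  have s3: "0 \<le> m / s ^ 3" using m s by simp
  have "1 * M \<le> s * M" by (rule mult_right_mono [OF s M])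
  then have MY: "M \<le> Y" and Y: "0 \<le> Y" using M s3 unfolding Y_def by linarith+
  have X_sum: "X = (\<Sum>\<omega>\<in>G. val V \<omega> * \<mu> \<omega>)"
    unfolding X_def V_def by (rule pairing_mass [OF G])
  have wnn: "0 \<le> \<mu> \<omega>" if "\<omega> \<in> G" for \<omega> using that G by (auto intro: \<mu>_nonneg)
  have Z0: "0 \<le> Z"
    unfolding Z_def pairing_def \<phi>_def I1_def I2_def
    by (intro sum_nonneg mult_nonneg_nonneg mass_nonneg E G)
  have "X\<^sup>2 = (\<Sum>\<omega>\<in>G. sqrt (\<mu> \<omega>) * (sqrt (\<mu> \<omega>) * val V \<omega>))\<^sup>2"
    unfolding X_sum
    by (rule arg_cong [where f = "\<lambda>t. t\<^sup>2"], rule sum.cong)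
       (simp_all add: wnn mult.assoc [symmetric])
  also have "\<dots> \<le> (\<Sum>\<omega>\<in>G. (sqrt (\<mu> \<omega>))\<^sup>2) * (\<Sum>\<omega>\<in>G. (sqrt (\<mu> \<omega>) * val V \<omega>)\<^sup>2)"
    by (rule Cauchy_Schwarz_ineq_sum)
  also have "\<dots> = M * (\<Sum>\<omega>\<in>G. (val V \<omega>)\<^sup>2 * \<mu> \<omega>)"
    by (simp add: M_def wnn power_mult_distrib mult.commute)
  also have "\<dots> \<le> M * (\<Sum>\<omega>\<in>G. (2 * d * val V \<omega> + 2 * val (II \<phi>) \<omega>) * \<mu> \<omega>)"
  proof (intro mult_left_mono sum_mono mult_right_mono wnn M)
    fix \<omega> assume "\<omega> \<in> G"
    then have "fst \<omega> \<in> T" "snd \<omega> \<in> S" using G points by auto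
    then show "(val V \<omega>)\<^sup>2 \<le> 2 * d * val V \<omega> + 2 * val (II \<phi>) \<omega>"
      unfolding V_def \<phi>_def
      by (rule II_square_le) (rule mass_nonneg [OF E], rule mass_mult_potential_le [OF E good])
  qed
  also have "(\<Sum>\<omega>\<in>G. (2 * d * val V \<omega> + 2 * val (II \<phi>) \<omega>) * \<mu> \<omega>) = 2 * d * X + 2 * Z"
    by (simp add: X_sum Z_def pairing_mass [OF G] sum.distrib sum_distrib_left algebra_simps)
  finally have X2: "X\<^sup>2 \<le> 2 * d * (M * X) + 2 * (M * Z)" by (simp add: algebra_simps)
  have "Z\<^sup>2 \<le> pairing \<phi> \<phi> * pairing (mass G) (mass G)"
    unfolding Z_def by (rule pairing_Cauchy_Schwarz)
  also have "\<dots> \<le> (4 * d\<^sup>2 * pairing (mass E) (mass E)) * (C * M)"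
  proof (rule mult_mono)
    show "pairing \<phi> \<phi> \<le> 4 * d\<^sup>2 * pairing (mass E) (mass E)"
      unfolding \<phi>_def
      by (rule norm_majorant_le)
         (rule mass_nonneg [OF E], rule d, rule sum_descendants_mass_le [OF E good])
    show "0 \<le> 4 * d\<^sup>2 * pairing (mass E) (mass E)"
      unfolding pairing_def by (intro mult_nonneg_nonneg sum_nonneg) (auto simp: mass_nonneg E)
    show "0 \<le> pairing (mass G) (mass G)"
      unfolding pairing_def by (intro sum_nonneg mult_nonneg_nonneg mass_nonneg G)
  qed (use energy_G in \<open>simp add: M_def\<close>)
  also have "\<dots> \<le> (4 * d\<^sup>2 * (d * m)) * (d * M)"
  proof -
    have "pairing (mass E) (mass E) \<le> d * m"
      using energy_E mult_right_mono [OF C(2) m] by (simp add: m_def)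
    moreover have "C * M \<le> d * M" by (rule mult_right_mono [OF C(2) M])
    ultimately show ?thesis
      using d C m M by (intro mult_mono) (auto simp: pairing_self_nonneg)
  qed
  finally have Z2: "Z\<^sup>2 \<le> 4 * d ^ 4 * (m * M)"
    by (simp add: power2_eq_square power4_eq_xxxx ac_simps)
  have "(M * Z)\<^sup>2 \<le> 4 * d ^ 4 * (m * M ^ 3)"
    using mult_left_mono [OF Z2, of "M\<^sup>2"]
    by (simp add: power_mult_distrib power2_eq_square power3_eq_cube ac_simps)
  \<comment> \<open>Both factors on the right are powers of summands of \<open>Y\<close>.\<close>
  also have "m * M ^ 3 = (m / s ^ 3) * (s * M) ^ 3"
    using s by (simp add: power_mult_distrib)
  also have "4 * d ^ 4 * \<dots> \<le> 4 * d ^ 4 * (Y * Y ^ 3)"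
    using s3 s M Y d unfolding Y_def
    by (intro mult_left_mono mult_mono power_mono) auto
  also have "\<dots> = (2 * d\<^sup>2 * Y\<^sup>2)\<^sup>2"
    by (simp add: power2_eq_square power3_eq_cube power4_eq_xxxx ac_simps)
  finally have MZ: "M * Z \<le> 2 * d\<^sup>2 * Y\<^sup>2"
    by (rule power2_le_imp_le) simp
  have X0: "0 \<le> X"
    unfolding X_def pairing_def by (intro sum_nonneg mult_nonneg_nonneg mass_nonneg E G)
  have "X \<le> 4 * d * Y"
  proof (rule ccontr)
    assume "\<not> X \<le> 4 * d * Y"
    then have big: "4 * d * Y < X" by simp
    have dY: "0 \<le> d * Y" using d Y by simp
    then have "2 * d * Y \<le> X" using big by linarith
    have "2 * d * (M * X) \<le> 2 * d * (Y * X)"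
      using MY X0 d by (intro mult_left_mono mult_right_mono) auto
    then have "X\<^sup>2 \<le> 2 * d * (Y * X) + 2 * (2 * d\<^sup>2 * Y\<^sup>2)"
      using X2 MZ by linarith
    also have "\<dots> = 2 * d * Y * X + (2 * d * Y) * (2 * d * Y)"
      by (simp add: power2_eq_square)
    also have "\<dots> \<le> 2 * d * Y * X + (2 * d * Y) * X"
      using \<open>2 * d * Y \<le> X\<close> dY by (intro add_left_mono mult_left_mono) linarith+
    also have "\<dots> = 4 * d * Y * X" by simp
    also have "\<dots> < X * X"
      using big dY by (intro mult_strict_right_mono) linarith+
    finally show False by (simp add: power2_eq_square)
  qed
  then show ?thesis by (simp add: X_def Y_def M_def m_def)
qed

text \<open>
  The energy condition bounds the average of the potential over \<open>E\<close> by \<open>C\<close>, so by Chebyshev's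
  inequality the potential exceeds \<open>2 C\<close> on at most half of the mass.  Passing to the subset only
  lowers the potential.
\<close>

lemma good_half:
  assumes E: "E \<subseteq> \<Omega>" and C: "0 < C" and energy: "pairing (mass E) (mass E) \<le> C * sum \<mu> E"
  obtains G where "G \<subseteq> E" "sum \<mu> E \<le> 2 * sum \<mu> G"
    "\<And>\<omega>. \<omega> \<in> G \<Longrightarrow> val (II (mass G)) \<omega> \<le> 2 * C"
proof
  define G where "G = {\<omega> \<in> E. val (II (mass E)) \<omega> \<le> 2 * C}"
  show GE: "G \<subseteq> E" by (auto simp: G_def)
  have split: "sum \<mu> E = sum \<mu> (E - G) + sum \<mu> G"
    by (rule sum.subset_diff [OF GE finite_sub [OF E]])
  have "2 * C * sum \<mu> (E - G) = (\<Sum>\<omega>\<in>E - G. 2 * C * \<mu> \<omega>)"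
    by (simp add: sum_distrib_left)
  also have "\<dots> \<le> (\<Sum>\<omega>\<in>E - G. val (II (mass E)) \<omega> * \<mu> \<omega>)"
    by (intro sum_mono mult_right_mono) (use E \<mu>_nonneg in \<open>auto simp: G_def\<close>)
  also have "\<dots> \<le> (\<Sum>\<omega>\<in>E. val (II (mass E)) \<omega> * \<mu> \<omega>)"
    using E \<mu>_nonneg
    by (intro sum_mono2 finite_sub [OF E] mult_nonneg_nonneg II_nonneg mass_nonneg) auto
  also have "\<dots> \<le> C * sum \<mu> E"
    using energy by (simp add: pairing_mass [OF E])
  finally have "2 * sum \<mu> (E - G) \<le> sum \<mu> E" using C by simp
  then show "sum \<mu> E \<le> 2 * sum \<mu> G" using split by linarith
  show "val (II (mass G)) \<omega> \<le> 2 * C" if "\<omega> \<in> G" for \<omega>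
  proof -
    have "val (II (mass G)) \<omega> \<le> val (II (mass E)) \<omega>"
      unfolding II_def by (intro sum_mono mass_mono GE E)
    then show ?thesis using that by (simp add: G_def)
  qed
qed

end

section \<open>The embedding\<close>

lemma sum_geometric_inj_le:
  assumes "finite A" "inj_on f A"
  shows "(\<Sum>j\<in>A. (1 / 2 :: real) ^ f j) \<le> 2"
proof -
  have "(\<Sum>j\<in>A. (1 / 2 :: real) ^ f j) = (\<Sum>n\<in>f ` A. (1 / 2) ^ n)"
    using assms(2) by (simp add: sum.reindex)
  also have "\<dots> \<le> (\<Sum>n. (1 / 2) ^ n)"
    by (rule sum_le_suminf) (use assms(1) in \<open>auto intro: summable_geometric\<close>)
  also have "\<dots> = 2" by (simp add: suminf_geometric)
  finally show ?thesis .
qed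

lemma sum_two_sided_geometric_le:
  fixes K :: "int set"
  assumes "finite K"
  shows "(\<Sum>j\<in>K. (1 / 2 :: real) ^ nat \<bar>k - j\<bar>) \<le> 4"
proof -
  let ?g = "\<lambda>j. (1 / 2 :: real) ^ nat \<bar>k - j\<bar>"
  have "sum ?g K = sum ?g (K \<inter> {..k}) + sum ?g (K - {..k})"
    using sum.Int_Diff [OF assms] .
  also have "sum ?g (K \<inter> {..k}) \<le> 2"
    by (rule sum_geometric_inj_le) (use assms in \<open>auto simp: inj_on_def\<close>)
  also have "sum ?g (K - {..k}) \<le> 2"
    by (rule sum_geometric_inj_le) (use assms in \<open>auto simp: inj_on_def\<close>)
  finally show ?thesis by simp
qed

context bi_tree_measure
begin

text \<open>
  For \<open>j \<le> k\<close> take \<open>s = 2\<close> to the power \<open>k - j\<close> in \<open>cross_energy_le\<close>; then \<open>u k = u j \<cdot> s\<^sup>2\<close>, and both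
  \<open>u j \<cdot> u k \<cdot> s \<cdot> \<mu>(G\<^sub>k)\<close> and \<open>u j \<cdot> u k \<cdot> \<mu>(G\<^sub>j) / s\<^sup>3\<close> are diagonal terms divided by \<open>s\<close>.  The base
  \<open>4\<close> of the levels is the square of the base of \<open>s\<close>; it makes the two gains equal.
\<close>

lemma weighted_masses_almost_orthogonal:
  fixes K :: "int set" and G :: "int \<Rightarrow> ('a set \<times> 'b set) set"
  defines "u \<equiv> \<lambda>k. 4 powr real_of_int k"
  assumes K: "finite K" and C: "0 \<le> C" "C \<le> d"
    and G: "\<And>k. k \<in> K \<Longrightarrow> G k \<subseteq> \<Omega>"
    and good: "\<And>k \<omega>. k \<in> K \<Longrightarrow> \<omega> \<in> G k \<Longrightarrow> val (II (mass (G k))) \<omega> \<le> d"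
    and energy: "\<And>k. k \<in> K \<Longrightarrow> pairing (mass (G k)) (mass (G k)) \<le> C * sum \<mu> (G k)"
  shows "pairing (\<lambda>a b. \<Sum>k\<in>K. u k * mass (G k) a b) (\<lambda>a b. \<Sum>k\<in>K. u k * mass (G k) a b)
    \<le> 32 * d * (\<Sum>k\<in>K. (u k)\<^sup>2 * sum \<mu> (G k))"
proof -
  define w where "w k = (u k)\<^sup>2 * sum \<mu> (G k)" for k
  define q where "q j k = (1 / 2 :: real) ^ nat \<bar>k - j\<bar>" for j k :: int
  have w: "0 \<le> w k" if "k \<in> K" for k
    using sum_\<mu>_nonneg [OF G [OF that]] by (simp add: w_def)
  have d: "0 \<le> d" using C by simp
  have ordered: "u j * u k * pairing (mass (G j)) (mass (G k)) \<le> 4 * d * q j k * (w j + w k)"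
    if jk: "j \<in> K" "k \<in> K" "j \<le> k" for j k
  proof -
    define s :: real where "s = 2 ^ nat (k - j)"
    have s: "1 \<le> s" by (simp add: s_def)
    have "u k = u j * 4 powr real_of_int (k - j)"
      by (simp add: u_def powr_add [symmetric])
    also have "4 powr real_of_int (k - j) = 4 ^ nat (k - j)"
      using jk(3) powr_realpow [of 4 "nat (k - j)"] by simp
    also have "\<dots> = s\<^sup>2"
      by (simp add: s_def power_mult [symmetric] mult.commute power_mult)
    finally have uk: "u k = u j * s\<^sup>2" .
    have qs: "q j k = 1 / s"
      using jk(3) by (simp add: q_def s_def power_one_over)
    have "u j * u k * pairing (mass (G j)) (mass (G k))
        \<le> u j * u k * (4 * d * (s * sum \<mu> (G k) + sum \<mu> (G j) / s ^ 3))"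
      by (intro mult_left_mono cross_energy_le [OF _ _ _ C s] G good energy jk) (simp_all add: u_def)
    also have "\<dots> = 4 * d * q j k * (w j + w k)"
      using s unfolding w_def uk qs
      by (simp add: field_simps power2_eq_square power3_eq_cube)
    finally show ?thesis .
  qed
  have pair: "u j * u k * pairing (mass (G j)) (mass (G k)) \<le> 4 * d * q j k * (w j + w k)"
    if "j \<in> K" "k \<in> K" for j k
  proof (cases "j \<le> k")
    case False
    have "u k * u j * pairing (mass (G k)) (mass (G j)) \<le> 4 * d * q k j * (w k + w j)"
      using False that by (intro ordered) auto
    moreover have "q k j = q j k" by (simp add: q_def abs_minus_commute)
    ultimately show ?thesis by (simp add: pairing_commute [of "mass (G k)"] ac_simps)
  qed (use ordered that in auto)
  have half: "(\<Sum>k\<in>K. \<Sum>j\<in>K. q j k * w k) \<le> 4 * sum w K"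
  proof -
    have "(\<Sum>k\<in>K. \<Sum>j\<in>K. q j k * w k) = (\<Sum>k\<in>K. (\<Sum>j\<in>K. q j k) * w k)"
      by (simp add: sum_distrib_right)
    also have "\<dots> \<le> (\<Sum>k\<in>K. 4 * w k)"
      unfolding q_def by (intro sum_mono mult_right_mono sum_two_sided_geometric_le K w)
    finally show ?thesis by (simp add: sum_distrib_left)
  qed
  have qsym: "q j k = q k j" for j k by (simp add: q_def abs_minus_commute)
  have "pairing (\<lambda>a b. \<Sum>k\<in>K. u k * mass (G k) a b) (\<lambda>a b. \<Sum>k\<in>K. u k * mass (G k) a b)
      = (\<Sum>k\<in>K. u k * pairing (mass (G k)) (\<lambda>a b. \<Sum>k\<in>K. u k * mass (G k) a b))"
    by (subst pairing_sum_right) (subst pairing_commute, rule refl)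
  also have "\<dots> = (\<Sum>k\<in>K. \<Sum>j\<in>K. u k * u j * pairing (mass (G k)) (mass (G j)))"
    by (simp add: pairing_sum_right sum_distrib_left mult.assoc)
  also have "\<dots> \<le> (\<Sum>k\<in>K. \<Sum>j\<in>K. 4 * d * q k j * (w k + w j))"
    by (intro sum_mono pair)
  also have "\<dots> = 4 * d * ((\<Sum>k\<in>K. \<Sum>j\<in>K. q j k * w k) + (\<Sum>k\<in>K. \<Sum>j\<in>K. q k j * w j))"
    by (simp add: sum_distrib_left sum.distrib algebra_simps qsym)
  also have "(\<Sum>k\<in>K. \<Sum>j\<in>K. q k j * w j) = (\<Sum>k\<in>K. \<Sum>j\<in>K. q j k * w k)"
    by (rule sum.swap)
  also have "4 * d * ((\<Sum>k\<in>K. \<Sum>j\<in>K. q j k * w k) + (\<Sum>k\<in>K. \<Sum>j\<in>K. q j k * w k))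
      \<le> 4 * d * (4 * sum w K + 4 * sum w K)"
    using d half by (intro mult_left_mono add_mono) auto
  finally show ?thesis by (simp add: w_def)
qed

text \<open>
  Hansson's argument.  Let \<open>W\<close> be the sum of \<open>(4\<^sup>k)\<^sup>2 \<cdot> \<mu>(G\<^sub>k)\<close>, which is comparable to the left-hand side.
  One factor \<open>4\<^sup>k\<close> is at most the Hardy sum on \<open>G\<^sub>k\<close>, so \<open>W\<close> is at most the pairing of \<open>\<phi>\<close> with
  a combination \<open>F\<close> of masses whose squared norm is, by almost orthogonality, at most a multiple of
  \<open>W\<close> itself.
\<close>

lemma Hardy_embedding_nonneg:
  assumes C: "0 < C"
    and energy: "\<And>E. E \<subseteq> \<Omega> \<Longrightarrow> pairing (mass E) (mass E) \<le> C * sum \<mu> E"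
    and \<phi>: "\<And>a b. 0 \<le> \<phi> a b"
  shows "(\<Sum>\<omega>\<in>\<Omega>. (val (II \<phi>) \<omega>)\<^sup>2 * \<mu> \<omega>) \<le> 2048 * C * pairing \<phi> \<phi>"
proof -
  define h where "h = val (II \<phi>)"
  define u where "u k = 4 powr real_of_int k" for k
  define lev where "lev \<omega> = \<lfloor>log 4 (h \<omega>)\<rfloor>" for \<omega>
  define P where "P = {\<omega> \<in> \<Omega>. 0 < h \<omega>}"
  define K where "K = lev ` P"
  define E where "E k = {\<omega> \<in> P. lev \<omega> = k}" for k
  have finP: "finite P" and finK: "finite K" using finite_points by (auto simp: P_def K_def)
  have E\<Omega>: "E k \<subseteq> \<Omega>" for k by (auto simp: E_def P_def)
  have h0: "0 \<le> h \<omega>" for \<omega> by (simp add: h_def II_nonneg \<phi>)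
  have level: "u k \<le> h \<omega>" "h \<omega> \<le> 4 * u k" if "\<omega> \<in> E k" for k \<omega>
  proof -
    have pos: "0 < h \<omega>" and k: "real_of_int k \<le> log 4 (h \<omega>)" "log 4 (h \<omega>) < real_of_int k + 1"
      using that by (auto simp: E_def P_def lev_def)
    show "u k \<le> h \<omega>" using pos k(1) by (simp add: u_def le_log_iff)
    have "h \<omega> < 4 powr (real_of_int k + 1)" using pos k(2) by (simp add: log_less_iff)
    then show "h \<omega> \<le> 4 * u k" by (simp add: u_def powr_add)
  qed
  have "\<exists>G. G \<subseteq> E k \<and> sum \<mu> (E k) \<le> 2 * sum \<mu> G \<and> (\<forall>\<omega>\<in>G. val (II (mass G)) \<omega> \<le> 2 * C)" for k
    by (rule good_half [OF E\<Omega> C energy [OF E\<Omega>]]) blast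
  then obtain G where G: "\<And>k. G k \<subseteq> E k" "\<And>k. sum \<mu> (E k) \<le> 2 * sum \<mu> (G k)"
    "\<And>k \<omega>. \<omega> \<in> G k \<Longrightarrow> val (II (mass (G k))) \<omega> \<le> 2 * C"
    by metis
  have G\<Omega>: "G k \<subseteq> \<Omega>" for k using G(1) E\<Omega> by blast
  define W where "W = (\<Sum>k\<in>K. (u k)\<^sup>2 * sum \<mu> (G k))"
  define F where "F a b = (\<Sum>k\<in>K. u k * mass (G k) a b)" for a b
  have W0: "0 \<le> W" unfolding W_def by (intro sum_nonneg mult_nonneg_nonneg sum_\<mu>_nonneg G\<Omega>) auto
  have "W \<le> pairing \<phi> F"
  proof -
    have "(u k)\<^sup>2 * sum \<mu> (G k) \<le> u k * pairing \<phi> (mass (G k))" for k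
    proof -
      have "u k * sum \<mu> (G k) = (\<Sum>\<omega>\<in>G k. u k * \<mu> \<omega>)" by (simp add: sum_distrib_left)
      also have "\<dots> \<le> (\<Sum>\<omega>\<in>G k. h \<omega> * \<mu> \<omega>)"
        using G(1) G\<Omega> by (intro sum_mono mult_right_mono level(1) \<mu>_nonneg) auto
      also have "\<dots> = pairing \<phi> (mass (G k))" by (simp add: pairing_mass [OF G\<Omega>] h_def)
      finally show ?thesis
        using mult_left_mono [of _ _ "u k"] by (simp add: power2_eq_square mult.assoc u_def)
    qed
    then show ?thesis unfolding W_def F_def pairing_sum_right by (intro sum_mono)
  qed
  then have "W\<^sup>2 \<le> (pairing \<phi> F)\<^sup>2" using W0 by (rule power_mono)
  also have "\<dots> \<le> pairing \<phi> \<phi> * pairing F F" by (rule pairing_Cauchy_Schwarz)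
  also have "\<dots> \<le> pairing \<phi> \<phi> * (32 * (2 * C) * W)"
    unfolding F_def W_def u_def
    by (intro mult_left_mono weighted_masses_almost_orthogonal [where C = C] finK G(3) G\<Omega> energy pairing_self_nonneg)
       (use C in auto)
  finally have "W * W \<le> (64 * C * pairing \<phi> \<phi>) * W" by (simp add: power2_eq_square ac_simps)
  then have W: "W \<le> 64 * C * pairing \<phi> \<phi>"
    using W0 C pairing_self_nonneg [of \<phi>] by (cases "W = 0") auto
  have "(\<Sum>\<omega>\<in>\<Omega>. (h \<omega>)\<^sup>2 * \<mu> \<omega>) = (\<Sum>\<omega>\<in>P. (h \<omega>)\<^sup>2 * \<mu> \<omega>)"
    by (rule sum.mono_neutral_right) (use finite_points h0 in \<open>auto simp: P_def less_le\<close>)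
  also have "\<dots> = (\<Sum>k\<in>K. \<Sum>\<omega>\<in>E k. (h \<omega>)\<^sup>2 * \<mu> \<omega>)"
    unfolding E_def by (rule sum.group [symmetric]) (auto simp: finP finK K_def)
  also have "\<dots> \<le> (\<Sum>k\<in>K. \<Sum>\<omega>\<in>E k. (4 * u k)\<^sup>2 * \<mu> \<omega>)"
    using E\<Omega> by (intro sum_mono mult_right_mono power_mono level(2) h0 \<mu>_nonneg) auto
  also have "\<dots> = (\<Sum>k\<in>K. (4 * u k)\<^sup>2 * sum \<mu> (E k))"
    by (simp add: sum_distrib_left)
  also have "\<dots> \<le> (\<Sum>k\<in>K. (4 * u k)\<^sup>2 * (2 * sum \<mu> (G k)))"
    by (intro sum_mono mult_left_mono G(2)) auto
  also have "\<dots> = 32 * W"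
    unfolding W_def sum_distrib_left [of 32] by (simp add: power_mult_distrib ac_simps)
  finally show ?thesis using W by (simp add: h_def)
qed

theorem Hardy_embedding:
  assumes C: "0 < C"
    and energy: "\<And>E. E \<subseteq> \<Omega> \<Longrightarrow> pairing (mass E) (mass E) \<le> C * sum \<mu> E"
  shows "(\<Sum>\<omega>\<in>\<Omega>. (val (II \<phi>) \<omega>)\<^sup>2 * \<mu> \<omega>) \<le> 2048 * C * pairing \<phi> \<phi>"
proof -
  have "\<bar>II \<phi> x y\<bar> \<le> II (\<lambda>a b. \<bar>\<phi> a b\<bar>) x y" for x y
    unfolding II_def by (rule order_trans [OF sum_abs]) (intro sum_mono sum_abs)
  then have "(val (II \<phi>) \<omega>)\<^sup>2 \<le> (val (II (\<lambda>a b. \<bar>\<phi> a b\<bar>)) \<omega>)\<^sup>2" for \<omega>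
    using power_mono [of "\<bar>val (II \<phi>) \<omega>\<bar>" _ 2] by simp
  then have "(\<Sum>\<omega>\<in>\<Omega>. (val (II \<phi>) \<omega>)\<^sup>2 * \<mu> \<omega>)
      \<le> (\<Sum>\<omega>\<in>\<Omega>. (val (II (\<lambda>a b. \<bar>\<phi> a b\<bar>)) \<omega>)\<^sup>2 * \<mu> \<omega>)"
    by (intro sum_mono mult_right_mono \<mu>_nonneg)
  also have "\<dots> \<le> 2048 * C * pairing (\<lambda>a b. \<bar>\<phi> a b\<bar>) (\<lambda>a b. \<bar>\<phi> a b\<bar>)"
    by (rule Hardy_embedding_nonneg [OF C energy]) auto
  finally show ?thesis by (simp add: pairing_def)
qed

end

section \<open>Dyadic rectangles\<close>

text \<open>
  The intervals are closed, so neighbours of the same length share an endpoint; the common point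
  \<open>p\<close> must be interior to both for them to be nested.
\<close>

lemma dyadic_interval_nested:
  assumes k: "k \<le> k'" and p: "real j < p * 2 ^ k" "p * 2 ^ k < real j + 1"
    and p': "real j' < p * 2 ^ k'" "p * 2 ^ k' < real j' + 1"
  shows "dyadic_interval k' j' \<subseteq> dyadic_interval k j"
proof -
  define D :: nat where "D = 2 ^ (k' - k)"
  have D: "0 < D" by (simp add: D_def)
  have pow: "(2 :: real) ^ k' = 2 ^ k * real D"
    using k by (simp add: D_def power_add [symmetric])
  have "real j * real D < (p * 2 ^ k) * real D" "(p * 2 ^ k) * real D < (real j + 1) * real D"
    using p D by (auto intro: mult_strict_right_mono)
  then have "real j * real D < real j' + 1" "real j' < (real j + 1) * real D"
    using p' by (simp_all add: pow mult.assoc)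
  then have "real (j * D) < real (j' + 1)" "real j' < real ((j + 1) * D)" 
    by (simp_all add: algebra_simps)
  then have "j * D \<le> j'" "j' + 1 \<le> (j + 1) * D" unfolding of_nat_less_iff by auto
  then have "real (j * D) \<le> real j'" "real (j' + 1) \<le> real ((j + 1) * D)"
    unfolding of_nat_le_iff .
  then have "real j * real D \<le> real j'" "real (j' + 1) \<le> real (j + 1) * real D"
    by (simp_all only: of_nat_mult)
  then have "real j / 2 ^ k \<le> real j' / 2 ^ k'" "real (j' + 1) / 2 ^ k' \<le> real (j + 1) / 2 ^ k"
    using D divide_right_mono [of "real j * real D" "real j'" "2 ^ k * real D"]
      divide_right_mono [of "real (j' + 1)" "real (j + 1) * real D" "2 ^ k * real D"]
    by (simp_all add: pow del: of_nat_add)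
  then show ?thesis by (auto simp: dyadic_interval_def)
qed

text \<open>
  The midpoint of a dyadic interval is interior to every dyadic interval that contains it, and serves as
  the point \<open>p\<close> above.
\<close>

lemma dyadic_interval_subset_bounds:
  assumes "dyadic_interval m i \<subseteq> dyadic_interval k j"
  shows "real j < (real i + 1 / 2) / 2 ^ m * 2 ^ k" "(real i + 1 / 2) / 2 ^ m * 2 ^ k < real j + 1"
proof -
  have "real i / 2 ^ m \<le> real (i + 1) / 2 ^ m" by (simp add: divide_right_mono)
  then have "real i / 2 ^ m \<in> dyadic_interval k j" "real (i + 1) / 2 ^ m \<in> dyadic_interval k j"
    using assms by (auto simp: dyadic_interval_def)
  then have "real j / 2 ^ k \<le> real i / 2 ^ m" "real (i + 1) / 2 ^ m \<le> real (j + 1) / 2 ^ k"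
    by (auto simp: dyadic_interval_def)
  moreover have "real i / 2 ^ m < (real i + 1 / 2) / 2 ^ m" "(real i + 1 / 2) / 2 ^ m < real (i + 1) / 2 ^ m"
    by (auto intro: divide_strict_right_mono)
  ultimately have "real j / 2 ^ k < (real i + 1 / 2) / 2 ^ m" "(real i + 1 / 2) / 2 ^ m < real (j + 1) / 2 ^ k"
    by linarith+
  then show "real j < (real i + 1 / 2) / 2 ^ m * 2 ^ k" "(real i + 1 / 2) / 2 ^ m * 2 ^ k < real j + 1"
    using pos_divide_less_eq [of "2 ^ k" "real j" "(real i + 1 / 2) / 2 ^ m"]
      pos_less_divide_eq [of "2 ^ k" "(real i + 1 / 2) / 2 ^ m" "real (j + 1)"] by simp_all
qed

lemma finite_tree_dyadic_tree: "finite_tree (dyadic_tree N)"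
proof
  show "finite (dyadic_tree N)" by (rule finite_dyadic_tree)
next
  fix x a a' assume *: "x \<in> dyadic_tree N" "a \<in> dyadic_tree N" "a' \<in> dyadic_tree N" "x \<subseteq> a" "x \<subseteq> a'"
  obtain m i k j k' j' where eq: "x = dyadic_interval m i" "a = dyadic_interval k j" "a' = dyadic_interval k' j'"
    using *(1-3) unfolding dyadic_tree_def by blast
  show "a \<subseteq> a' \<or> a' \<subseteq> a"
    using dyadic_interval_subset_bounds [of m i k j] dyadic_interval_subset_bounds [of m i k' j'] *(4,5)
      dyadic_interval_nested [of k k' j _ j'] dyadic_interval_nested [of k' k j' _ j] nat_le_linear [of k k']
    unfolding eq by blast
qed

text \<open>
  Inclusion of rectangles is inclusion of both sides because dyadic intervals are nonempty.
\<close>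

lemma node_le_iff:
  assumes "\<alpha> \<in> bitree N"
  shows "\<alpha> \<preceq> \<beta> \<longleftrightarrow> fst \<alpha> \<subseteq> fst \<beta> \<and> snd \<alpha> \<subseteq> snd \<beta>"
proof -
  have "x \<noteq> {}" if "x \<in> dyadic_tree N" for x
    using that by (auto simp: dyadic_tree_def dyadic_interval_def divide_right_mono)
  then have "fst \<alpha> \<noteq> {}" "snd \<alpha> \<noteq> {}" using assms by (auto simp: bitree_def)
  then show ?thesis by (auto simp: node_le_def rect_def times_subset_iff)
qed

theorem theorem1p9:
  shows "\<forall>C::real. C > 0 \<longrightarrow> (\<exists>C\<^sub>1::real. C\<^sub>1 > 0 \<and>
    (\<forall>(N::nat) (\<mu> :: node \<Rightarrow> real).
      N \<ge> 1 \<longrightarrow> measure_on_boundary N \<mu> \<longrightarrow>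
      (\<forall>E. E \<subseteq> bitree_boundary N \<longrightarrow>
        energy N (restrict_measure \<mu> E) \<le> C * set_mass \<mu> E) \<longrightarrow>
      (\<forall>\<phi> :: node \<Rightarrow> real.
        (\<Sum>\<omega>\<in>bitree_boundary N. \<bar>hardy N \<phi> \<omega>\<bar>\<^sup>2 * \<mu> \<omega>) \<le> C\<^sub>1 * l2_norm_sq N \<phi>)))"
proof (intro allI impI)
  fix C :: real assume C: "C > 0"
  have "(\<Sum>\<omega>\<in>bitree_boundary N. \<bar>hardy N \<phi> \<omega>\<bar>\<^sup>2 * \<mu> \<omega>) \<le> 2048 * C * l2_norm_sq N \<phi>"
    if \<mu>: "measure_on_boundary N \<mu>"
      and REC: "\<forall>E. E \<subseteq> bitree_boundary N \<longrightarrow> energy N (restrict_measure \<mu> E) \<le> C * set_mass \<mu> E"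
    for N \<mu> \<phi>
  proof -
    interpret finite_tree "dyadic_tree N" by (rule finite_tree_dyadic_tree)
    interpret bi_tree_measure "dyadic_tree N" "dyadic_tree N" "bitree_boundary N" \<mu>
      by unfold_locales
        (use bitree_boundary_subset \<mu> in \<open>auto simp: bitree_def measure_on_boundary_def\<close>)
    have hardy: "hardy N \<phi> \<omega> = val (II (curry \<phi>)) \<omega>" if "\<omega> \<in> bitree_boundary N" for \<omega>
    proof -
      have "\<omega> \<in> bitree N" using that bitree_boundary_subset by blast
      then have "{\<beta>. \<beta> \<in> bitree N \<and> \<omega> \<preceq> \<beta>} = anc (dyadic_tree N) (fst \<omega>) \<times> anc (dyadic_tree N) (snd \<omega>)"
        by (auto simp: node_le_iff bitree_def anc_def)
      then show ?thesis
        by (simp add: hardy_def II_def sum.cartesian_product case_prod_beta)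
    qed
    have mass: "rect_mass N (restrict_measure \<mu> E) \<alpha> = val (mass E) \<alpha>"
      if "E \<subseteq> bitree_boundary N" for E \<alpha>
    proof -
      have "{\<omega>. \<omega> \<in> bitree_boundary N \<and> \<omega> \<preceq> \<alpha>} \<inter> E = {\<omega>. \<omega> \<in> E \<and> fst \<omega> \<subseteq> fst \<alpha> \<and> snd \<omega> \<subseteq> snd \<alpha>}"
        using that bitree_boundary_subset [of N] by (auto simp: node_le_iff [of _ N] subset_iff)
      then show ?thesis
        by (simp add: rect_mass_def restrict_measure_def mass_def sum.inter_restrict [symmetric]
            finite_bitree_boundary)
    qed
    have "pairing (mass E) (mass E) \<le> C * sum \<mu> E" if "E \<subseteq> bitree_boundary N" for E
      using REC that
      by (simp add: energy_def mass set_mass_def pairing_cartesian bitree_def case_prod_beta power2_eq_square)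
    then have "(\<Sum>\<omega>\<in>bitree_boundary N. (val (II (curry \<phi>)) \<omega>)\<^sup>2 * \<mu> \<omega>) \<le> 2048 * C * pairing (curry \<phi>) (curry \<phi>)"
      by (rule Hardy_embedding [OF C])
    then show ?thesis
      by (simp add: hardy l2_norm_sq_def pairing_cartesian bitree_def case_prod_beta power2_eq_square)
  qed
  then show "\<exists>C\<^sub>1>0. \<forall>N \<mu>. N \<ge> 1 \<longrightarrow> measure_on_boundary N \<mu> \<longrightarrow>
      (\<forall>E. E \<subseteq> bitree_boundary N \<longrightarrow> energy N (restrict_measure \<mu> E) \<le> C * set_mass \<mu> E) \<longrightarrow>
      (\<forall>\<phi>. (\<Sum>\<omega>\<in>bitree_boundary N. \<bar>hardy N \<phi> \<omega>\<bar>\<^sup>2 * \<mu> \<omega>) \<le> C\<^sub>1 * l2_norm_sq N \<phi>)"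
    using C by (intro exI [of _ "2048 * C"]) auto
qed

end
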